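(* Let $\Omega_i=\mathbb{R}^{m_i}$, and let $\gamma^{1*}:\Omega_2\times\Omega_3\to\Omega_1$ be the announced optimal affine reverse Stackelberg strategy of the leader. Suppose that $\operatorname{conv}(\bar W^{3d})$ is locally strictly convex at $(u^{2d},u^{3d})$ and that $\bar J_3$ is differentiable at $(u^{2d},u^{3d})$. If $(u^{2d},u^{3d})$ is an exposed point of $\operatorname{conv}(\bar W^{3d})$ and $\nabla_{u^2}\bar J_3(u^{2d},u^{3d})\ne 0$, then there exists an (affine) optimal strategy $\gamma^{2*}:\Omega_3\to\Omega_2$ of the middle level player, with $\gamma^{2*}(u^{3d})=u^{2d}$, such that $$u^{3d}=\operatorname*{argmin}_{u^3\in\Omega_3}J_3\big(\gamma^{1*}(\gamma^{2*}(u^3),u^3),\gamma^{2*}(u^3),u^3\big),$$ i.e. $u^{3d}$ is the unique minimizer.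
   Context: Trilevel static game: the leader, the middle level player and the follower choose $u^1\in\Omega_1$, $u^2\in\Omega_2$, $u^3\in\Omega_3$ respectively, where $\Omega_i=\mathbb{R}^{m_i}$, $m_i\ge 1$, and minimize cost functions $J_1,J_2,J_3:\Omega_1\times\Omega_2\times\Omega_3\to\mathbb{R}$ respectively. $J_1$ is assumed to have a unique global minimizer $(u^{1d},u^{2d},u^{3d})$, called the desired equilibrium. The sublevel sets $\{J_i\le J_i(u^{1d},u^{2d},u^{3d})\}$, $i=2,3$, are assumed connected (not necessarily convex). An optimal affine reverse Stackelberg strategy of the leader is an affine map $\gamma^{1*}:\Omega_2\times\Omega_3\to\Omega_1$ with $\gamma^{1*}(u^{2d},u^{3d})=u^{1d}$ such that $(u^{2d},u^{3d})$ is the unique minimizer of $(u^2,u^3)\mapsto J_2(\gamma^{1*}(u^2,u^3),u^2,u^3)$ over $\Omega_2\times\Omega_3$. For the fixed $\gamma^{1*}$, $\bar J_3(u^2,u^3)=J_3(\gamma^{1*}(u^2,u^3),u^2,u^3)$ and $\bar W^{3d}=\{(u^2,u^3)\in\Omega_2\times\Omega_3:\bar J_3(u^2,u^3)\le\bar J_3(u^{2d},u^{3d})\}$. $\operatorname{conv}$ denotes the convex hull. A point $x$ of a convex set $K$ is exposed if there is a supporting hyperplane of $K$ meeting $K$ only at $x$. Admissible strategies of the middle level player are the affine maps $\gamma^2:\Omega_3\to\Omega_2$ with $\gamma^2(u^{3d})=u^{2d}$. A set $W$ is locally strictly convex at a point $x\in W$ if $x$ is a boundary point of $W$ and there is a neighbourhood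 $U$ of $x$ such that for every $y\in W\cap U$, $y\ne x$, the open segment between $x$ and $y$ lies in the interior of $W$. *)

theory Defs
  imports "HOL-Analysis.Analysis"
begin

definition affine_map :: "('a::real_vector \<Rightarrow> 'b::real_vector) \<Rightarrow> bool" where
  "affine_map f \<longleftrightarrow> (\<exists>L c. linear L \<and> (\<forall>x. f x = L x + c))"

text \<open>\<open>x\<close> is the only element of the argmin set of \<open>f\<close> over the whole space.\<close>
definition unique_minimizer :: "('a \<Rightarrow> real) \<Rightarrow> 'a \<Rightarrow> bool" where
  "unique_minimizer f x \<longleftrightarrow> (\<forall>y. is_arg_min f (\<lambda>_. True) y \<longleftrightarrow> y = x)"

text \<open>Only meaningful where \<open>f\<close> is differentiable; the gradient is then unique.\<close>
definition gradient :: "('a::real_inner \<Rightarrow> real) \<Rightarrow> 'a \<Rightarrow> 'a" where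
  "gradient f x = (THE D. GDERIV f x :> D)"

definition locally_strictly_convex_at :: "'a::real_normed_vector set \<Rightarrow> 'a \<Rightarrow> bool" where
  "locally_strictly_convex_at W x \<longleftrightarrow>
     x \<in> W \<and> x \<in> frontier W \<and>
     (\<exists>U. open U \<and> x \<in> U \<and>
        (\<forall>y \<in> W \<inter> U. y \<noteq> x \<longrightarrow> open_segment x y \<subseteq> interior W))"

text \<open>
  In the library notion \<^const>\<open>exposed_face_of\<close> the normal vector may vanish, so it differs from
  the use of genuine hyperplanes for improper faces. For a singleton face this only concerns
  \<open>K = {x}\<close>, where in positive dimension a genuine supporting hyperplane exists as well.
\<close>
abbreviation exposed_point_of :: "'a::euclidean_space \<Rightarrow> 'a set \<Rightarrow> bool" where
  "exposed_point_of x K \<equiv> {x} exposed_face_of K"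

text \<open>Cost, as a function of \<open>(u\<^sup>2, u\<^sup>3)\<close>, once the leader has announced \<open>\<gamma>1\<close>.\<close>
definition reduced_cost :: "('a \<times> 'b \<times> 'c \<Rightarrow> real) \<Rightarrow> ('b \<times> 'c \<Rightarrow> 'a) \<Rightarrow> 'b \<times> 'c \<Rightarrow> real" where
  "reduced_cost J \<gamma>1 = (\<lambda>(u2, u3). J (\<gamma>1 (u2, u3), u2, u3))"

definition reduced_sublevel ::
    "('a \<times> 'b \<times> 'c \<Rightarrow> real) \<Rightarrow> ('b \<times> 'c \<Rightarrow> 'a) \<Rightarrow> 'b \<times> 'c \<Rightarrow> ('b \<times> 'c) set" where
  "reduced_sublevel J \<gamma>1 w = {v. reduced_cost J \<gamma>1 v \<le> reduced_cost J \<gamma>1 w}"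

definition optimal_leader_strategy ::
    "('a::real_vector \<times> 'b::real_vector \<times> 'c::real_vector \<Rightarrow> real)
     \<Rightarrow> 'a \<Rightarrow> 'b \<Rightarrow> 'c \<Rightarrow> ('b \<times> 'c \<Rightarrow> 'a) \<Rightarrow> bool" where
  "optimal_leader_strategy J2 u1d u2d u3d \<gamma>1 \<longleftrightarrow>
     affine_map \<gamma>1 \<and> \<gamma>1 (u2d, u3d) = u1d \<and>
     unique_minimizer (reduced_cost J2 \<gamma>1) (u2d, u3d)"

definition admissible_middle_strategy ::
    "'b::real_vector \<Rightarrow> 'c::real_vector \<Rightarrow> ('c \<Rightarrow> 'b) \<Rightarrow> bool" where
  "admissible_middle_strategy u2d u3d \<gamma>2 \<longleftrightarrow> affine_map \<gamma>2 \<and> \<gamma>2 u3d = u2d"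

definition follower_response ::
    "('a \<times> 'b \<times> 'c \<Rightarrow> real) \<Rightarrow> ('b \<times> 'c \<Rightarrow> 'a) \<Rightarrow> ('c \<Rightarrow> 'b) \<Rightarrow> 'c \<Rightarrow> bool" where
  "follower_response J3 \<gamma>1 \<gamma>2 u3 \<longleftrightarrow>
     is_arg_min (\<lambda>v. J3 (\<gamma>1 (\<gamma>2 v, v), \<gamma>2 v, v)) (\<lambda>_. True) u3"

text \<open>
  Optimality for the middle level player: the follower has an optimal response, and whichever
  optimal response the follower picks, the resulting cost \<open>J2\<close> does not exceed the cost of any
  outcome attainable under an admissible strategy.
\<close>
definition optimal_middle_strategy ::
    "('a \<times> 'b::real_vector \<times> 'c::real_vector \<Rightarrow> real) \<Rightarrow> ('a \<times> 'b \<times> 'c \<Rightarrow> real)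
     \<Rightarrow> ('b \<times> 'c \<Rightarrow> 'a) \<Rightarrow> 'b \<Rightarrow> 'c \<Rightarrow> ('c \<Rightarrow> 'b) \<Rightarrow> bool" where
  "optimal_middle_strategy J2 J3 \<gamma>1 u2d u3d \<gamma>2 \<longleftrightarrow>
     admissible_middle_strategy u2d u3d \<gamma>2 \<and>
     (\<exists>u3. follower_response J3 \<gamma>1 \<gamma>2 u3) \<and>
     (\<forall>u3 \<gamma> v. follower_response J3 \<gamma>1 \<gamma>2 u3 \<longrightarrow>
        admissible_middle_strategy u2d u3d \<gamma> \<longrightarrow> follower_response J3 \<gamma>1 \<gamma> v \<longrightarrow>
        reduced_cost J2 \<gamma>1 (\<gamma>2 u3, u3) \<le> reduced_cost J2 \<gamma>1 (\<gamma> v, v))"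

end

theory Submission
  imports Defs
begin

text \<open>
  Let \<open>w = (u\<^sup>2\<^sup>d, u\<^sup>3\<^sup>d)\<close> and let \<open>a\<close> be normal to a hyperplane exposing \<open>w\<close>. Every strict descent
  direction of the follower's reduced cost at \<open>w\<close> points into the sublevel set, hence strictly to
  the negative side of \<open>a\<close>. If the \<open>u\<^sup>2\<close>-part of \<open>a\<close> vanished, no direction \<open>(h, 0)\<close> would be a
  descent direction and the partial gradient would be zero. So the exposing hyperplane contains
  the graph of an affine map of \<open>u\<^sup>3\<close>; on that graph the reduced cost exceeds its value at \<open>w\<close>
  except at \<open>w\<close> itself.
\<close>

lemma unique_minimizer_iff:
  "unique_minimizer f x \<longleftrightarrow> (\<forall>y. y \<noteq> x \<longrightarrow> f x < f y)"
  unfolding unique_minimizer_def is_arg_min_def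
  by (metis linorder_neqE not_less_iff_gr_or_eq)

text \<open>The description by \<open>THE\<close> is well defined: the Frechet derivative is unique,
  and a vector is determined by its inner products.\<close>

lemma gradient_eq:
  assumes "GDERIV f x :> D"
  shows "gradient f x = D"
  unfolding gradient_def
proof (rule the_equality[of _ D])
  show "GDERIV f x :> D" by fact
next
  fix E assume "GDERIV f x :> E"
  then have "(\<lambda>h. h \<bullet> E) = (\<lambda>h. h \<bullet> D)"
    using assms has_derivative_unique unfolding gderiv_def by blast
  then show "E = D"
    by (metis vector_eq_ldot)
qed

text \<open>Restricted to the ray \<open>t \<mapsto> w + t *\<^sub>R d\<close>, the function has the
  negative one-variable derivative \<open>D d\<close> at 0, so it drops just to the right of
  0.\<close>

lemma descent_direction:
  fixes f :: "'a::real_normed_vector \<Rightarrow> real"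
  assumes f: "(f has_derivative D) (at w)" and "D d < 0"
  obtains t where "t > 0" "f (w + t *\<^sub>R d) < f w"
proof -
  have "((\<lambda>t. w + t *\<^sub>R d) has_derivative (\<lambda>t. t *\<^sub>R d)) (at 0)"
    by (auto intro!: derivative_eq_intros)
  then have "((\<lambda>t. f (w + t *\<^sub>R d)) has_derivative (\<lambda>t. D (t *\<^sub>R d))) (at 0)"
    by (rule has_derivative_compose) (use f in simp)
  then have "DERIV (\<lambda>t. f (w + t *\<^sub>R d)) 0 :> D d"
    unfolding has_field_derivative_def
    by (simp add: linear_scale[OF has_derivative_linear[OF f]] mult.commute[of _ "D d"])
  from DERIV_neg_dec_right[OF this \<open>D d < 0\<close>]
  obtain e where "e > 0" "\<forall>h>0. h < e \<longrightarrow> f (w + (0 + h) *\<^sub>R d) < f (w + 0 *\<^sub>R d)"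
    by blast
  then show thesis
    using that[of "e / 2"] by simp
qed

lemma exposing_normal_descent:
  fixes f :: "'a::euclidean_space \<Rightarrow> real"
  assumes f: "(f has_derivative D) (at w)" and "D d < 0"
    and exposed: "\<And>x. f x \<le> f w \<Longrightarrow> x \<noteq> w \<Longrightarrow> a \<bullet> x < a \<bullet> w"
  shows "a \<bullet> d < 0"
proof -
  obtain t where t: "t > 0" "f (w + t *\<^sub>R d) < f w"
    using descent_direction[OF f \<open>D d < 0\<close>] .
  then have "a \<bullet> (w + t *\<^sub>R d) < a \<bullet> w"
    by (intro exposed) auto
  then show ?thesis
    using t by (simp add: inner_add_right mult_less_0_iff)
qed

lemma exposing_normal_fst_nonzero:
  fixes f :: "'a::euclidean_space \<times> 'b::euclidean_space \<Rightarrow> real"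
  assumes "f differentiable (at (x, y))"
    and exposed: "\<And>v. f v \<le> f (x, y) \<Longrightarrow> v \<noteq> (x, y) \<Longrightarrow> (p, q) \<bullet> v < (p, q) \<bullet> (x, y)"
    and grad: "gradient (\<lambda>u. f (u, y)) x \<noteq> 0"
  shows "p \<noteq> 0"
proof
  assume "p = 0"
  obtain D where D: "(f has_derivative D) (at (x, y))"
    using assms(1) unfolding differentiable_def by blast
  \<comment> \<open>A descent direction \<open>(h, 0)\<close> would give
    \<open>(p, q) \<bullet> (h, 0) < 0\<close>, but this product is
    \<open>p \<bullet> h = 0\<close>.\<close>
  have nonneg: "0 \<le> D (h, 0)" for h
    using exposing_normal_descent[OF D _ exposed, of "(h, 0)"] \<open>p = 0\<close> by fastforce
  \<comment> \<open>The bound for \<open>- h\<close> reverses the sign by linearity of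
    \<open>D\<close>.\<close>
  have "D (h, 0) = 0" for h
    using nonneg[of h] nonneg[of "- h"] linear_neg[OF has_derivative_linear[OF D], of "(h, 0)"]
    by simp
  moreover have "((\<lambda>u. f (u, y)) has_derivative (\<lambda>h. D (h, 0))) (at x)"
    by (rule has_derivative_compose[of "\<lambda>u. (u, y)" "\<lambda>h. (h, 0)" x UNIV f D])
      (use D in \<open>auto intro!: derivative_eq_intros\<close>)
  ultimately have "GDERIV (\<lambda>u. f (u, y)) x :> 0"
    by (simp add: gderiv_def)
  then show False
    using gradient_eq grad by blast
qed

lemma affine_graph_in_hyperplane:
  fixes p x :: "'a::real_inner" and q y :: "'b::real_inner"
  assumes "p \<noteq> 0"
  obtains \<gamma> :: "'b \<Rightarrow> 'a" where "affine_map \<gamma>" "\<gamma> y = x"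
    "\<And>v. (p, q) \<bullet> (\<gamma> v, v) = (p, q) \<bullet> (x, y)"
proof
  \<comment> \<open>Moving \<open>x\<close> along \<open>p\<close> by this multiple changes the
    first product by \<open>- (q \<bullet> (v - y))\<close>, which cancels the change in the second;
    dividing by \<open>p \<bullet> p\<close> is where \<open>p \<noteq> 0\<close> enters.\<close>
  define \<gamma> where "\<gamma> v = x - ((q \<bullet> (v - y)) / (p \<bullet> p)) *\<^sub>R p" for v
  have "linear (\<lambda>v. - ((q \<bullet> v) / (p \<bullet> p)) *\<^sub>R p)"
    by (rule linearI) (simp_all add: inner_add_right add_divide_distrib scaleR_left_distrib scaleR_left_diff_distrib)
  moreover have "\<gamma> v = - ((q \<bullet> v) / (p \<bullet> p)) *\<^sub>R p + (x + ((q \<bullet> y) / (p \<bullet> p)) *\<^sub>R p)" for v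
    by (simp add: \<gamma>_def inner_diff_right diff_divide_distrib scaleR_left_diff_distrib)
  ultimately show "affine_map \<gamma>"
    unfolding affine_map_def by blast
  show "\<gamma> y = x"
    by (simp add: \<gamma>_def)
  show "(p, q) \<bullet> (\<gamma> v, v) = (p, q) \<bullet> (x, y)" for v
    using assms by (simp add: \<gamma>_def inner_diff_right)
qed

theorem proposition3p15:
  fixes J1 J2 J3 :: "(real ^ 'm1) \<times> (real ^ 'm2) \<times> (real ^ 'm3) \<Rightarrow> real"
    and u1d :: "real ^ 'm1" and u2d :: "real ^ 'm2" and u3d :: "real ^ 'm3"
    and \<gamma>1 :: "(real ^ 'm2) \<times> (real ^ 'm3) \<Rightarrow> real ^ 'm1"
  assumes "unique_minimizer J1 (u1d, u2d, u3d)"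
    and "connected {u. J2 u \<le> J2 (u1d, u2d, u3d)}"
    and "connected {u. J3 u \<le> J3 (u1d, u2d, u3d)}"
    and "optimal_leader_strategy J2 u1d u2d u3d \<gamma>1"
    and "locally_strictly_convex_at (convex hull (reduced_sublevel J3 \<gamma>1 (u2d, u3d))) (u2d, u3d)"
    and "reduced_cost J3 \<gamma>1 differentiable (at (u2d, u3d))"
    and "exposed_point_of (u2d, u3d) (convex hull (reduced_sublevel J3 \<gamma>1 (u2d, u3d)))"
    and "gradient (\<lambda>u2. reduced_cost J3 \<gamma>1 (u2, u3d)) u2d \<noteq> 0"
  shows "\<exists>\<gamma>2 :: real ^ 'm3 \<Rightarrow> real ^ 'm2.
           affine_map \<gamma>2 \<and> \<gamma>2 u3d = u2d \<and>
           optimal_middle_strategy J2 J3 \<gamma>1 u2d u3d \<gamma>2 \<and>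
           unique_minimizer (\<lambda>u3. J3 (\<gamma>1 (\<gamma>2 u3, u3), \<gamma>2 u3, u3)) u3d"
proof -
  let ?f = "reduced_cost J3 \<gamma>1" and ?g = "reduced_cost J2 \<gamma>1" and ?w = "(u2d, u3d)"
  let ?C = "convex hull (reduced_sublevel J3 \<gamma>1 ?w)"
  \<comment> \<open>Here \<open>a\<close> might still be zero; \<open>p \<noteq> 0\<close>, obtained
    below from the gradient, excludes this.\<close>
  obtain a b where C: "?C \<subseteq> {x. a \<bullet> x \<le> b}" and w: "{?w} = ?C \<inter> {x. a \<bullet> x = b}"
    using assms(7) unfolding exposed_face_of_def by blast
  obtain p q where a: "a = (p, q)"
    by (cases a)
  have exposed: "(p, q) \<bullet> v < (p, q) \<bullet> ?w" if "?f v \<le> ?f ?w" "v \<noteq> ?w" for v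
  proof -
    have "v \<in> ?C"
      using that(1) by (simp add: hull_inc reduced_sublevel_def)
    \<comment> \<open>Equality at \<open>v\<close> would put \<open>v\<close> into the exposed face,
      which is only \<open>?w\<close>.\<close>
    then have "a \<bullet> v \<le> b" "a \<bullet> v \<noteq> b" "a \<bullet> ?w = b"
      using C w that(2) by blast+
    then show ?thesis
      unfolding a by linarith
  qed
  have "p \<noteq> 0"
    using exposing_normal_fst_nonzero[OF assms(6) exposed assms(8)] .
  then obtain \<gamma>2 where \<gamma>2: "affine_map \<gamma>2" "\<gamma>2 u3d = u2d"
    and graph: "\<And>v. (p, q) \<bullet> (\<gamma>2 v, v) = (p, q) \<bullet> ?w"
    using affine_graph_in_hyperplane[of p u3d u2d q] by blast
  have "?f ?w < ?f (\<gamma>2 v, v)" if "v \<noteq> u3d" for v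
    using exposed[of "(\<gamma>2 v, v)"] graph[of v] that by fastforce
  then have min: "unique_minimizer (\<lambda>v. J3 (\<gamma>1 (\<gamma>2 v, v), \<gamma>2 v, v)) u3d"
    by (simp add: unique_minimizer_iff reduced_cost_def \<gamma>2(2))
  \<comment> \<open>The leader's strategy makes \<open>?w\<close> a global minimizer of the middle
    player's reduced cost, so forcing the follower's response to be \<open>u3d\<close> is already
    optimal.\<close>
  have "?g ?w \<le> ?g v" for v
    using assms(4) unfolding optimal_leader_strategy_def unique_minimizer_iff
    by (cases "v = ?w") (simp, blast intro: less_imp_le)
  moreover have "follower_response J3 \<gamma>1 \<gamma>2 v \<longleftrightarrow> v = u3d" for v
    using min unfolding follower_response_def unique_minimizer_def by blast
  ultimately have "optimal_middle_strategy J2 J3 \<gamma>1 u2d u3d \<gamma>2"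
    using \<gamma>2 by (simp add: optimal_middle_strategy_def admissible_middle_strategy_def)
  with \<gamma>2 min show ?thesis
    by blast
qed

end
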